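(* Let $\varphi(z)=\sum_{k=1}^{\infty}\alpha_kz^k$ and $\psi(z)=\sum_{k=0}^{\infty}\beta_kz^k$ be holomorphic in the open unit disk $\mathbb{D}$ with $\alpha_1\neq0$, $\beta_0\neq0$, and put $b:=\frac{1}{\alpha_1\beta_0}$. Let $F\in\mathcal{A}_{\varphi,\psi}$ and let $G=F^{-1}\in\mathcal{B}_{\varphi,\psi}$ have the expansion $G(z)=\sum_{k=1}^\infty b_kz^k$. Then the coefficient $b_2$ lies in the closed disk centered at $c=-\alpha_2\beta_0b^3$ of radius $r=|\alpha_1\beta_1|\cdot|b|^3$, that is, $$\left|b_2+\alpha_2\beta_0b^3 \right| \leq |\alpha_1\beta_1|\cdot|b|^3.$$ Consequently, if $\beta_1=0$ then $b_2=-\alpha_2\beta_0 b^3$. Otherwise, if $\beta_1\neq0$ but equality holds in the displayed inequality, then there exists $\theta\in\mathbb{R}$ such that $$F(z)=\varphi(z)\psi(e^{i\theta}z).$$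
   Context: $\mathcal{A}_{\varphi,\psi}$ is the class of functions $F$ holomorphic in $\mathbb{D}$ of the form $F(z)=\varphi(z)\psi(\omega(z))$, $z\in\mathbb{D}$, for some holomorphic self-mapping $\omega$ of $\mathbb{D}$ with $\omega(0)=0$. Since $F(0)=0$ and $F'(0)=\alpha_1\beta_0\neq0$, $F$ has a local inverse $F^{-1}$ near zero with $F^{-1}(0)=0$, and $\mathcal{B}_{\varphi,\psi}:=\{F^{-1}:F\in\mathcal{A}_{\varphi,\psi}\}$. *)

theory Defs
  imports "HOL-Complex_Analysis.Complex_Analysis"
begin

definition class_A :: "(complex \<Rightarrow> complex) \<Rightarrow> (complex \<Rightarrow> complex) \<Rightarrow> (complex \<Rightarrow> complex) set" where
  "class_A \<phi> \<psi> = {F. F holomorphic_on ball 0 1 \<and>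
     (\<exists>\<omega>. \<omega> holomorphic_on ball 0 1 \<and> \<omega> ` ball 0 1 \<subseteq> ball 0 1 \<and> \<omega> 0 = 0 \<and>
        (\<forall>z\<in>ball 0 1. F z = \<phi> z * \<psi> (\<omega> z)))}"

text \<open>The local inverse of a function on the unit disk is a germ at the origin. It is represented
  by any total function that inverts \<open>F\<close> between some neighbourhoods of the origin;
  its values away from the origin are irrelevant.\<close>

definition local_inverse :: "(complex \<Rightarrow> complex) \<Rightarrow> (complex \<Rightarrow> complex) \<Rightarrow> bool" where
  "local_inverse F G \<longleftrightarrow>
     (\<exists>U V. open U \<and> open V \<and> 0 \<in> U \<and> U \<subseteq> ball 0 1 \<and> 0 \<in> V \<and>
        homeomorphism U V F G \<and> G holomorphic_on V \<and> G 0 = 0)"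

definition class_B :: "(complex \<Rightarrow> complex) \<Rightarrow> (complex \<Rightarrow> complex) \<Rightarrow> (complex \<Rightarrow> complex) set" where
  "class_B \<phi> \<psi> = {G. \<exists>F\<in>class_A \<phi> \<psi>. local_inverse F G}"

end

theory Submission
  imports Defs
begin

text \<open>
  Write \<open>c\<close> for the derivative at \<open>0\<close> of the Schwarz function \<open>\<omega>\<close> with
  \<open>F = \<phi> \<cdot> (\<psi> \<circ> \<omega>)\<close>. Near the origin \<open>F\<close> has the expansion
  \<open>\<alpha>\<^sub>1 \<beta>\<^sub>0 z + (\<alpha>\<^sub>2 \<beta>\<^sub>0 + \<alpha>\<^sub>1 \<beta>\<^sub>1 c) z\<^sup>2 + \<dots>\<close>, so only \<open>c\<close> is free in the first two coefficients.
  Comparing the coefficients of \<open>z\<^sup>2\<close> in \<open>G (F z) = z\<close>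
  (lemma \<open>fps_compositional_inverse_nth_2\<close>) gives
  \<open>g\<^sub>2 + \<alpha>\<^sub>2 \<beta>\<^sub>0 b\<^sup>3 = - \<alpha>\<^sub>1 \<beta>\<^sub>1 c b\<^sup>3\<close>. The Schwarz lemma bounds \<open>\<bar>c\<bar>\<close> by \<open>1\<close>,
  which is the claimed disk. If the boundary of a disk of positive radius is attained, then
  \<open>\<bar>c\<bar> = 1\<close>, and the equality case of the Schwarz lemma makes \<open>\<omega>\<close> a rotation.
\<close>

lemma fps_compose_nth_1:
  fixes f g :: "'a::comm_ring_1 fps"
  shows "fps_nth (f oo g) 1 = fps_nth f 1 * fps_nth g 1"
  by (simp add: fps_compose_nth)

lemma fps_compose_nth_2:
  fixes f g :: "'a::comm_ring_1 fps"
  assumes "fps_nth g 0 = 0"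
  shows "fps_nth (f oo g) 2 = fps_nth f 1 * fps_nth g 2 + fps_nth f 2 * (fps_nth g 1)\<^sup>2"
  using assms by (simp add: fps_compose_nth numeral_2_eq_2 fps_mult_nth)

text \<open>
  The case \<open>n = 2\<close> of Lagrange inversion, read off from the coefficients of \<open>X\<close> and \<open>X\<^sup>2\<close>
  in \<open>g oo f = X\<close>. The first one also shows that \<open>f\<close> has an invertible linear coefficient.
\<close>

lemma fps_compositional_inverse_nth_2:
  fixes f g :: "'a::field fps"
  assumes "fps_nth f 0 = 0" and "g oo f = fps_X"
  shows "fps_nth g 2 = - fps_nth f 2 / fps_nth f 1 ^ 3"
proof -
  have 1: "fps_nth g 1 * fps_nth f 1 = 1"
    using fps_compose_nth_1[of g f] assms(2) by simp
  have 2: "fps_nth g 1 * fps_nth f 2 + fps_nth g 2 * (fps_nth f 1)\<^sup>2 = 0"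
    using fps_compose_nth_2[OF assms(1), of g] assms(2) by simp
  from 1 have nz: "fps_nth f 1 \<noteq> 0"
    by auto
  have "fps_nth g 2 * fps_nth f 1 ^ 3 = fps_nth f 1 * (fps_nth g 2 * (fps_nth f 1)\<^sup>2)"
    by (simp add: power2_eq_square power3_eq_cube)
  also have "\<dots> = - (fps_nth g 1 * fps_nth f 1) * fps_nth f 2"
    using 2 by (simp add: eq_neg_iff_add_eq_0 algebra_simps flip: distrib_left)
  finally show ?thesis
    using 1 nz by (simp add: field_simps)
qed

text \<open>
  A series indexed from \<open>Suc 0\<close> leaves the constant coefficient \<open>a 0\<close> undetermined; as a power
  series it stands for the one with constant coefficient \<open>0\<close>.
\<close>

lemma has_fps_expansion_of_Suc_sums:
  fixes f :: "complex \<Rightarrow> complex"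
  assumes "\<forall>\<^sub>F z in nhds 0. (\<lambda>k. a (Suc k) * z ^ Suc k) sums f z"
  shows "f has_fps_expansion Abs_fps (a(0 := 0))"
proof (rule has_fps_expansionI)
  show "\<forall>\<^sub>F z in nhds 0. (\<lambda>k. fps_nth (Abs_fps (a(0 := 0))) k * z ^ k) sums f z"
    using assms
  proof eventually_elim
    case (elim z)
    then show ?case
      using sums_Suc_iff[of "\<lambda>k. fps_nth (Abs_fps (a(0 := 0))) k * z ^ k" "f z"] by simp
  qed
qed

lemma local_inverse_fps_compose:
  assumes "local_inverse F G" and "F has_fps_expansion f" and "G has_fps_expansion g"
    and "fps_nth f 0 = 0"
  shows "g oo f = fps_X"
proof (rule fps_expansion_unique_complex)
  show "(G \<circ> F) has_fps_expansion (g oo f)"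
    using assms by (intro has_fps_expansion_compose)
  obtain U V where U: "open U" "0 \<in> U" and hom: "homeomorphism U V F G"
    using assms(1) unfolding local_inverse_def by auto
  have "\<forall>\<^sub>F z in nhds 0. (G \<circ> F) z = z"
    using eventually_nhds_in_open[OF U] by eventually_elim (simp add: homeomorphism_apply1[OF hom])
  then show "(G \<circ> F) has_fps_expansion fps_X"
    using has_fps_expansion_fps_X by (subst has_fps_expansion_cong[OF _ refl])
qed

theorem proposition4p1:
  fixes \<phi> \<psi> F G :: "complex \<Rightarrow> complex"
    and \<alpha> \<beta> g :: "nat \<Rightarrow> complex"
    and b :: complex
  assumes "\<phi> holomorphic_on ball 0 1"
    and "\<And>z. z \<in> ball 0 1 \<Longrightarrow> (\<lambda>k. \<alpha> (Suc k) * z ^ Suc k) sums \<phi> z"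
    and "\<psi> holomorphic_on ball 0 1"
    and "\<And>z. z \<in> ball 0 1 \<Longrightarrow> (\<lambda>k. \<beta> k * z ^ k) sums \<psi> z"
    and "\<alpha> 1 \<noteq> 0" and "\<beta> 0 \<noteq> 0"
    and "b = 1 / (\<alpha> 1 * \<beta> 0)"
    and "F \<in> class_A \<phi> \<psi>"
    and "G \<in> class_B \<phi> \<psi>" and "local_inverse F G"
    and "\<forall>\<^sub>F z in nhds 0. (\<lambda>k. g (Suc k) * z ^ Suc k) sums G z"
  shows "g 2 \<in> cball (- \<alpha> 2 * \<beta> 0 * b ^ 3) (norm (\<alpha> 1 * \<beta> 1) * norm b ^ 3)
    \<and> norm (g 2 + \<alpha> 2 * \<beta> 0 * b ^ 3) \<le> norm (\<alpha> 1 * \<beta> 1) * norm b ^ 3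
    \<and> (\<beta> 1 = 0 \<longrightarrow> g 2 = - \<alpha> 2 * \<beta> 0 * b ^ 3)
    \<and> (\<beta> 1 \<noteq> 0 \<and> norm (g 2 + \<alpha> 2 * \<beta> 0 * b ^ 3) = norm (\<alpha> 1 * \<beta> 1) * norm b ^ 3
        \<longrightarrow> (\<exists>\<theta>::real. \<forall>z\<in>ball 0 1. F z = \<phi> z * \<psi> (exp (\<i> * complex_of_real \<theta>) * z)))"
proof -
  have disk: "\<forall>\<^sub>F z in nhds (0::complex). z \<in> ball 0 1"
    by (intro eventually_nhds_in_open) auto
  obtain \<omega> where \<omega>: "\<omega> holomorphic_on ball 0 1" "\<omega> ` ball 0 1 \<subseteq> ball 0 1" "\<omega> 0 = 0"
    and F_eq: "\<And>z. z \<in> ball 0 1 \<Longrightarrow> F z = \<phi> z * \<psi> (\<omega> z)"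
    using assms(8) unfolding class_A_def by auto
  define c where "c = deriv \<omega> 0"
  define p where "p = Abs_fps (\<alpha>(0 := 0))"
  define q where "q = Abs_fps \<beta>"
  define w where "w = fps_expansion \<omega> 0"
  define f where "f = p * (q oo w)"
  have \<phi>_exp: "\<phi> has_fps_expansion p"
    unfolding p_def by (intro has_fps_expansion_of_Suc_sums eventually_mono[OF disk] assms(2))
  have \<psi>_exp: "\<psi> has_fps_expansion q"
    unfolding q_def by (intro has_fps_expansionI eventually_mono[OF disk]) (simp add: assms(4))
  have \<omega>_exp: "\<omega> has_fps_expansion w"
    unfolding w_def using \<omega>(1) by (intro has_fps_expansion_fps_expansion[of "ball 0 1"]) auto
  have w_nth: "fps_nth w 0 = 0" "fps_nth w 1 = c"
    using \<omega>(3) by (simp_all add: w_def c_def fps_expansion_def)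
  have F_exp: "F has_fps_expansion f"
  proof -
    have "(\<lambda>z. \<phi> z * (\<psi> \<circ> \<omega>) z) has_fps_expansion f"
      unfolding f_def
      by (intro has_fps_expansion_mult has_fps_expansion_compose \<phi>_exp \<psi>_exp \<omega>_exp w_nth)
    moreover have "\<forall>\<^sub>F z in nhds 0. F z = \<phi> z * (\<psi> \<circ> \<omega>) z"
      using disk by eventually_elim (simp add: F_eq)
    ultimately show ?thesis
      by (subst has_fps_expansion_cong[OF _ refl])
  qed
  have f_nth: "fps_nth f 0 = 0" "fps_nth f 1 = \<alpha> 1 * \<beta> 0"
    "fps_nth f 2 = \<alpha> 2 * \<beta> 0 + \<alpha> 1 * \<beta> 1 * c"
    using fps_compose_nth_1[of q w] w_nth
    by (simp_all add: f_def p_def q_def fps_mult_nth numeral_2_eq_2)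
  have G_exp: "G has_fps_expansion Abs_fps (g(0 := 0))"
    by (rule has_fps_expansion_of_Suc_sums) (rule assms(11))
  have "Abs_fps (g(0 := 0)) oo f = fps_X"
    by (rule local_inverse_fps_compose[OF assms(10) F_exp G_exp f_nth(1)])
  from fps_compositional_inverse_nth_2[OF f_nth(1) this]
  have "g 2 = - (\<alpha> 2 * \<beta> 0 + \<alpha> 1 * \<beta> 1 * c) * b ^ 3"
    by (simp add: f_nth[unfolded One_nat_def] assms(7) divide_inverse power_inverse power_mult_distrib)
  then have key: "g 2 + \<alpha> 2 * \<beta> 0 * b ^ 3 = - (\<alpha> 1 * \<beta> 1 * c * b ^ 3)"
    by algebra
  then have norm_eq: "norm (g 2 + \<alpha> 2 * \<beta> 0 * b ^ 3) = norm (\<alpha> 1 * \<beta> 1) * norm b ^ 3 * norm c"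
    by (simp add: norm_mult norm_power)

  have \<omega>_less: "norm (\<omega> z) < 1" if "norm z < 1" for z
    using \<omega>(2) that by (auto simp: image_subset_iff)
  note schwarz = Schwarz_Lemma'[OF \<omega>(1,3) \<omega>_less, folded c_def]
  have bound: "norm (g 2 + \<alpha> 2 * \<beta> 0 * b ^ 3) \<le> norm (\<alpha> 1 * \<beta> 1) * norm b ^ 3"
    unfolding norm_eq using schwarz by (intro mult_left_le) auto
  then have "g 2 \<in> cball (- \<alpha> 2 * \<beta> 0 * b ^ 3) (norm (\<alpha> 1 * \<beta> 1) * norm b ^ 3)"
    by (simp add: dist_norm norm_minus_commute[of _ "g 2"])
  moreover have "g 2 = - \<alpha> 2 * \<beta> 0 * b ^ 3" if "\<beta> 1 = 0"
    using key that by (simp add: eq_neg_iff_add_eq_0)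
  moreover have "\<exists>\<theta>::real. \<forall>z\<in>ball 0 1. F z = \<phi> z * \<psi> (exp (\<i> * complex_of_real \<theta>) * z)"
    if "\<beta> 1 \<noteq> 0" and eq: "norm (g 2 + \<alpha> 2 * \<beta> 0 * b ^ 3) = norm (\<alpha> 1 * \<beta> 1) * norm b ^ 3"
  proof -
    have "norm (\<alpha> 1 * \<beta> 1) * norm b ^ 3 \<noteq> 0"
      using assms(5-7) that(1) by simp
    then have "norm c = 1"
      using eq unfolding norm_eq by simp
    then obtain u where u: "\<And>z. norm z < 1 \<Longrightarrow> \<omega> z = u * z" "norm u = 1"
      using schwarz by blast
    have "u \<noteq> 0"
      using u(2) by auto
    then have "exp (\<i> * complex_of_real (Arg u)) = u"
      using Arg_eq u(2) by (metis mult_1 of_real_1)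
    then show ?thesis
      using F_eq u(1) by (intro exI[of _ "Arg u"]) auto
  qed
  ultimately show ?thesis
    using bound by blast
qed

end
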